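(* Let $(X,\mathcal{B})$ be an $\mathbf{S}_1$ ball space and let $f:X\to X$ be a function. 1) If every nonempty $f$-closed subset of $X$ contains an $f$-contracting ball, then $f$ has a fixed point in each nonempty $f$-closed subset of $X$. 2) If every nonempty $f$-closed subset of $X$ is an $f$-contracting ball, then $f$ has a unique fixed point.
   Context: A ball space $(X,\mathcal{B})$ consists of a nonempty set $X$ and a nonempty family $\mathcal{B}$ of nonempty subsets of $X$, called balls. A nest of balls is a nonempty subset of $\mathcal{B}$ which is totally ordered by inclusion. $(X,\mathcal{B})$ is an $\mathbf{S}_1$ ball space (equivalently: is spherically complete) if every nest of balls has nonempty intersection. For a function $f:X\to X$, a subset $S\subseteq X$ is $f$-closed if $f(S)\subseteq S$. An $f$-closed set $S$ is $f$-contracting if $f(S)\subsetneq S$ unless $S$ is a singleton (so every $f$-closed singleton is $f$-contracting). An $f$-contracting ball is an element of $\mathcal{B}$ that is an $f$-contracting (in particular $f$-closed) set. *)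

theory Defs
  imports "HOL-Library.FuncSet"
begin

definition ball_space :: "'a set \<Rightarrow> 'a set set \<Rightarrow> bool" where
  "ball_space X \<B> \<longleftrightarrow> X \<noteq> {} \<and> \<B> \<noteq> {} \<and> (\<forall>B\<in>\<B>. B \<noteq> {} \<and> B \<subseteq> X)"

definition nest_of_balls :: "'a set set \<Rightarrow> 'a set set \<Rightarrow> bool" where
  "nest_of_balls \<B> \<N> \<longleftrightarrow> \<N> \<noteq> {} \<and> subset.chain \<B> \<N>"

definition S1_ball_space :: "'a set \<Rightarrow> 'a set set \<Rightarrow> bool" where
  "S1_ball_space X \<B> \<longleftrightarrow>
     ball_space X \<B> \<and> (\<forall>\<N>. nest_of_balls \<B> \<N> \<longrightarrow> \<Inter>\<N> \<noteq> {})"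

definition f_closed :: "'a set \<Rightarrow> ('a \<Rightarrow> 'a) \<Rightarrow> 'a set \<Rightarrow> bool" where
  "f_closed X f S \<longleftrightarrow> S \<subseteq> X \<and> f ` S \<subseteq> S"

definition f_contracting :: "'a set \<Rightarrow> ('a \<Rightarrow> 'a) \<Rightarrow> 'a set \<Rightarrow> bool" where
  "f_contracting X f S \<longleftrightarrow> f_closed X f S \<and> (\<not> is_singleton S \<longrightarrow> f ` S \<subset> S)"

definition f_contracting_ball :: "'a set \<Rightarrow> 'a set set \<Rightarrow> ('a \<Rightarrow> 'a) \<Rightarrow> 'a set \<Rightarrow> bool" where
  "f_contracting_ball X \<B> f B \<longleftrightarrow> B \<in> \<B> \<and> f_contracting X f B"

end

theory Submission
  imports Defs
begin

text \<open>
  Zorn's lemma, in the form of a maximal chain, supplies a minimal contracting ball, and such a ball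
  must be a singleton. In detail: fix a nonempty \<open>f\<close>-closed set \<open>S\<close> and take a maximal chain \<open>\<N>\<close> of
  contracting balls inside \<open>S\<close>. Spherical completeness makes \<open>\<Inter>\<N>\<close> nonempty, and it is closed as an
  intersection of closed sets, so it contains a contracting ball \<open>B\<close>. By maximality every contracting
  ball inside \<open>\<Inter>\<N>\<close> belongs to \<open>\<N>\<close> and therefore equals \<open>\<Inter>\<N>\<close>
  (\<open>ex_minimal_contracting_ball\<close>). If \<open>B\<close> were not a singleton, \<open>f ` B\<close> would be a closed set properly
  inside \<open>B\<close>, and a contracting ball inside it would contradict minimality. Hence \<open>B = {x}\<close>, and
  closedness says \<open>f x = x\<close> (\<open>ex_fixed_point\<close>).

  When all nonempty closed sets are contracting balls, existence is the previous argument applied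
  to \<open>X\<close>, and two fixed points \<open>x\<close>, \<open>y\<close> coincide because \<open>f\<close> maps the contracting set \<open>{x, y}\<close>
  onto itself, which forces that set to be a singleton.
\<close>

lemma f_closed_Inter:
  assumes "\<N> \<noteq> {}" and "\<forall>N\<in>\<N>. f_closed X f N"
  shows "f_closed X f (\<Inter>\<N>)"
  using assms unfolding f_closed_def by blast

lemma f_closed_image:
  assumes "f_closed X f S"
  shows "f_closed X f (f ` S)"
  using assms unfolding f_closed_def by blast

text \<open>Adding a lower bound to a chain gives a chain again, so a maximal chain contains all its lower
  bounds in \<open>\<A>\<close>. This turns maximality of the chain into minimality of a ball.\<close>

lemma lower_bound_in_maxchain:
  assumes max: "subset.maxchain \<A> \<N>" and "B \<in> \<A>" and "\<And>N. N \<in> \<N> \<Longrightarrow> B \<subseteq> N"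
  shows "B \<in> \<N>"
proof (rule ccontr)
  assume "B \<notin> \<N>"
  have "subset.chain \<A> \<N>"
    using max by (simp add: subset.maxchain_def)
  then have "subset.chain \<A> (insert B \<N>)"
    using assms(2,3) unfolding subset_chain_def by blast
  moreover have "\<N> \<subset> insert B \<N>"
    using \<open>B \<notin> \<N>\<close> by blast
  ultimately show False
    using max unfolding subset.maxchain_def by blast
qed

text \<open>Spherical completeness only provides a common point of a chain of balls, not a ball below it.
  The hypothesis
  on closed sets closes this gap, since the intersection of the chain is itself a closed set.\<close>

lemma ex_minimal_contracting_ball:
  assumes S1: "S1_ball_space X \<B>"
    and contr: "\<And>T. T \<noteq> {} \<Longrightarrow> f_closed X f T \<Longrightarrow> \<exists>B\<subseteq>T. f_contracting_ball X \<B> f B"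
    and S: "S \<noteq> {}" "f_closed X f S"
  shows "\<exists>B\<subseteq>S. f_contracting_ball X \<B> f B
    \<and> (\<forall>B'\<subseteq>B. f_contracting_ball X \<B> f B' \<longrightarrow> B' = B)"
proof -
  define \<A> where "\<A> = {B. B \<subseteq> S \<and> f_contracting_ball X \<B> f B}"
  obtain \<N> where max: "subset.maxchain \<A> \<N>"
    using subset.Hausdorff[of \<A>] by (rule exE)
  then have chain: "subset.chain \<A> \<N>"
    by (simp add: subset.maxchain_def)
  then have sub: "\<N> \<subseteq> \<A>"
    by (simp add: subset_chain_def)
  have "\<N> \<noteq> {}"
    using contr[OF S] lower_bound_in_maxchain[OF max] unfolding \<A>_def by blast
  moreover have "subset.chain \<B> \<N>"
    using chain unfolding subset_chain_def \<A>_def f_contracting_ball_def by blast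
  ultimately have "\<Inter>\<N> \<noteq> {}"
    using S1 by (simp add: S1_ball_space_def nest_of_balls_def)
  moreover have "f_closed X f (\<Inter>\<N>)"
    using sub \<open>\<N> \<noteq> {}\<close>
    by (intro f_closed_Inter) (auto simp: \<A>_def f_contracting_ball_def f_contracting_def)
  ultimately obtain B where B: "B \<subseteq> \<Inter>\<N>" "f_contracting_ball X \<B> f B"
    using contr[of "\<Inter>\<N>"] by metis
  have "\<Inter>\<N> \<subseteq> S"
    using sub \<open>\<N> \<noteq> {}\<close> unfolding \<A>_def by blast
  \<comment> \<open>A contracting ball below all of \<open>\<N>\<close> lies in \<open>\<N>\<close>, so it also contains \<open>\<Inter>\<N>\<close>.\<close>
  have eq: "B' = \<Inter>\<N>" if "B' \<subseteq> \<Inter>\<N>" "f_contracting_ball X \<B> f B'" for B'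
  proof -
    have "B' \<in> \<A>"
      using that \<open>\<Inter>\<N> \<subseteq> S\<close> unfolding \<A>_def by blast
    then have "B' \<in> \<N>"
      using that(1) by (intro lower_bound_in_maxchain[OF max]) auto
    with that(1) show ?thesis by blast
  qed
  have "B \<subseteq> S"
    using B(1) \<open>\<Inter>\<N> \<subseteq> S\<close> by (rule subset_trans)
  moreover have "B = \<Inter>\<N>"
    using B by (rule eq)
  ultimately show ?thesis
    using B(2) eq by metis
qed

lemma ex_fixed_point:
  assumes S1: "S1_ball_space X \<B>"
    and contr: "\<And>T. T \<noteq> {} \<Longrightarrow> f_closed X f T \<Longrightarrow> \<exists>B\<subseteq>T. f_contracting_ball X \<B> f B"
    and S: "S \<noteq> {}" "f_closed X f S"
  shows "\<exists>x\<in>S. f x = x"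
proof -
  obtain B where B: "B \<subseteq> S" "f_contracting_ball X \<B> f B"
    and minimal: "\<And>B'. B' \<subseteq> B \<Longrightarrow> f_contracting_ball X \<B> f B' \<Longrightarrow> B' = B"
    using ex_minimal_contracting_ball[OF S1 contr S] by blast
  have closed: "f_closed X f B"
    using B(2) by (simp add: f_contracting_ball_def f_contracting_def)
  have "B \<noteq> {}"
    using B(2) S1 by (auto simp: f_contracting_ball_def S1_ball_space_def ball_space_def)
  have "is_singleton B"
  proof (rule ccontr)
    assume "\<not> is_singleton B"
    then have "f ` B \<subset> B"
      using B(2) by (simp add: f_contracting_ball_def f_contracting_def)
    moreover obtain B' where "B' \<subseteq> f ` B" "f_contracting_ball X \<B> f B'"
      using contr[of "f ` B"] \<open>B \<noteq> {}\<close> f_closed_image[OF closed] by blast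
    ultimately show False
      using minimal[of B'] by blast
  qed
  then obtain x where "B = {x}"
    by (rule is_singletonE)
  with B(1) closed show ?thesis
    by (auto simp: f_closed_def)
qed

lemma fixed_points_eq_if_pair_contracting:
  assumes "f_contracting X f {x, y}" and "f x = x" and "f y = y"
  shows "x = y"
proof -
  have "f ` {x, y} = {x, y}"
    using assms(2,3) by simp
  then have "is_singleton {x, y}"
    using assms(1) by (auto simp: f_contracting_def)
  then show ?thesis
    by (auto elim!: is_singletonE simp: doubleton_eq_iff)
qed

theorem theorem2p1:
  fixes X :: "'a set" and \<B> :: "'a set set" and f :: "'a \<Rightarrow> 'a"
  assumes "S1_ball_space X \<B>"
    and "f \<in> X \<rightarrow> X"
  shows "((\<forall>S. S \<noteq> {} \<and> f_closed X f S \<longrightarrow> (\<exists>B. B \<subseteq> S \<and> f_contracting_ball X \<B> f B))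
            \<longrightarrow> (\<forall>S. S \<noteq> {} \<and> f_closed X f S \<longrightarrow> (\<exists>x\<in>S. f x = x)))
       \<and> ((\<forall>S. S \<noteq> {} \<and> f_closed X f S \<longrightarrow> f_contracting_ball X \<B> f S)
            \<longrightarrow> (\<exists>!x. x \<in> X \<and> f x = x))"
proof (intro conjI impI allI)
  fix S
  assume "\<forall>S. S \<noteq> {} \<and> f_closed X f S \<longrightarrow> (\<exists>B. B \<subseteq> S \<and> f_contracting_ball X \<B> f B)"
    and "S \<noteq> {} \<and> f_closed X f S"
  then show "\<exists>x\<in>S. f x = x"
    using ex_fixed_point[OF assms(1), of f S] by blast
next
  assume all: "\<forall>S. S \<noteq> {} \<and> f_closed X f S \<longrightarrow> f_contracting_ball X \<B> f S"
  have "X \<noteq> {}"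
    using assms(1) by (simp add: S1_ball_space_def ball_space_def)
  moreover have "f_closed X f X"
    using assms(2) by (auto simp: f_closed_def)
  ultimately have "\<exists>x\<in>X. f x = x"
    using ex_fixed_point[OF assms(1), of f X] all by blast
  moreover have "x = y" if "x \<in> X" "f x = x" "y \<in> X" "f y = y" for x y
  proof (rule fixed_points_eq_if_pair_contracting)
    have "f_closed X f {x, y}"
      using that by (simp add: f_closed_def)
    then show "f_contracting X f {x, y}"
      using all by (simp add: f_contracting_ball_def)
  qed (use that in auto)
  ultimately show "\<exists>!x. x \<in> X \<and> f x = x"
    by blast
qed

end
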